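(* For all integers $d\ge 2$ and $N\ge 1$, there exists a $(d,N,p)$ probabilistic Port-Based State Preparation protocol with probability of success $$p = 1-\left(1-\frac{1}{d}\right)^N .$$
   Context: Probabilistic Port-Based State Preparation (PBSP). Alice holds $N$ qudits $A=A_1\cdots A_N$ and Bob holds $N$ qudits $B=B_1\cdots B_N$ (each register is a copy of $\mathbb{C}^d$). They share a fixed resource state $\rho_{AB}$ (a density operator on $A\otimes B$, chosen by the protocol and independent of the input). The input is the complete (arbitrarily precise) classical description $\psi$ of a pure state $|\psi\rangle\in\mathbb{C}^d$, known to Alice only. Alice performs on $A$ an $(N+1)$-outcome POVM $\{M_x(\psi)\}_{x=0}^N$, which may depend on $\psi$, and sends the outcome $x$ to Bob. If $x=0$, Bob aborts (failure). If $x\in\{1,\dots,N\}$, Bob traces out all of his registers except $B_x$ (the "port"). A $(d,N,p)$ probabilistic PBSP protocol is such a choice of $\rho_{AB}$ and POVMs $\{M_x(\psi)\}_x$ for which, for every input $\psi$: (i) for every $x\in\{1,\dots,N\}$ occurring with nonzero probability, the post-measurement state of port $B_x$ is exactly the desired state, i.e. $\mathrm{Tr}_{A B_{\bar x}}[(M_x(\psi)\otimes I_B)\rho_{AB}] = \mathrm{Tr}[(M_x(\psi)\otimes I_B)\rho_{AB}]\,|\psi\rangle\langle\psi|$, where $B_{\bar x}$ denotes all of Bob's registers other than $B_x$; (ii) the success probability is $p$: $1-\mathrm{Tr}[(M_0(\psi)\otimes I_B)\rho_{AB}] = p$. *)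

theory Defs
  imports "HOL-Analysis.Analysis"
begin

text \<open>
  Conventions: the local dimension is \<open>d = CARD('d)\<close> and the number of ports is \<open>N = CARD('n)\<close>.
  The computational basis of \<open>N\<close> qudits is indexed by the functions \<open>'n \<Rightarrow> 'd\<close> (port label to
  local basis label), that of the joint system \<open>AB\<close> by pairs of such functions, Alice's label first.
  An operator \<open>X\<close> is its matrix, with \<open>X $ i $ j\<close> the entry \<open>\<langle>i|X|j\<rangle>\<close>.
\<close>

type_synonym 'i operator = "complex^'i^'i"
type_synonym ('d, 'n) qudits_operator = "('n \<Rightarrow> 'd) operator"
type_synonym ('d, 'n) joint_operator = "(('n \<Rightarrow> 'd) \<times> ('n \<Rightarrow> 'd)) operator"

definition adjoint_matrix :: "'i::finite operator \<Rightarrow> 'i operator" where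
  "adjoint_matrix X = map_matrix cnj (transpose X)"

text \<open>The real part below is harmless: the form is real for self-adjoint \<open>X\<close>.\<close>

definition positive_semidefinite :: "'i::finite operator \<Rightarrow> bool" where
  "positive_semidefinite X \<longleftrightarrow>
     adjoint_matrix X = X \<and> (\<forall>v. 0 \<le> Re (\<Sum>i\<in>UNIV. cnj (v $ i) * (X *v v) $ i))"

definition density_operator :: "'i::finite operator \<Rightarrow> bool" where
  "density_operator X \<longleftrightarrow> positive_semidefinite X \<and> trace X = 1"

definition POVM :: "('x::finite \<Rightarrow> 'i::finite operator) \<Rightarrow> bool" where
  "POVM E \<longleftrightarrow> (\<forall>x. positive_semidefinite (E x)) \<and> (\<Sum>x\<in>UNIV. E x) = mat 1"

definition tensor_op ::
  "'i::finite operator \<Rightarrow> 'j::finite operator \<Rightarrow> ('i \<times> 'j) operator" where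
  "tensor_op X Y = (\<chi> r c. X $ fst r $ fst c * Y $ snd r $ snd c)"

definition partial_trace_fst :: "('i::finite \<times> 'j::finite) operator \<Rightarrow> 'j operator" where
  "partial_trace_fst X = (\<chi> r c. \<Sum>a\<in>UNIV. X $ (a, r) $ (a, c))"

text \<open>
  Trace over all registers but the one at port \<open>x\<close>. For an entry \<open>(i, j)\<close> the row label \<open>b\<close> has
  \<open>b x = i\<close>, the column label has \<open>j\<close> at \<open>x\<close>, and the two agree at every other port.
\<close>

definition reduce_to_port ::
  "'n::finite \<Rightarrow> ('d::finite, 'n) qudits_operator \<Rightarrow> 'd operator" where
  "reduce_to_port x Y = (\<chi> i j. \<Sum>b | b x = i. Y $ b $ (b(x := j)))"

definition pure_state_projector :: "complex^'i::finite \<Rightarrow> 'i operator" where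
  "pure_state_projector \<psi> = (\<chi> i j. \<psi> $ i * cnj (\<psi> $ j))"

text \<open>\<open>(M \<otimes> I\<^sub>B) \<rho>\<close>; its trace is the probability of the outcome with effect \<open>M\<close>.\<close>

definition measured ::
  "('d::finite, 'n::finite) qudits_operator \<Rightarrow> ('d, 'n) joint_operator \<Rightarrow> ('d, 'n) joint_operator"
  where "measured M \<rho> = tensor_op M (mat 1) ** \<rho>"

text \<open>
  A \<open>(CARD('d), CARD('n), p)\<close> probabilistic PBSP protocol. The outcome \<open>0\<close> (abort) is \<open>None\<close>,
  and the outcome naming port \<open>x\<close> is \<open>Some x\<close>. The input is a unit vector; the values of \<open>M\<close> at
  other vectors are irrelevant.
\<close>

definition probabilistic_PBSP ::
  "('d::finite, 'n::finite) joint_operator \<Rightarrow>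
   (complex^'d \<Rightarrow> 'n option \<Rightarrow> ('d, 'n) qudits_operator) \<Rightarrow> real \<Rightarrow> bool" where
  "probabilistic_PBSP \<rho> M p \<longleftrightarrow>
     density_operator \<rho> \<and>
     (\<forall>\<psi>. norm \<psi> = 1 \<longrightarrow>
        POVM (M \<psi>) \<and>
        (\<forall>x. trace (measured (M \<psi> (Some x)) \<rho>) \<noteq> 0 \<longrightarrow>
           reduce_to_port x (partial_trace_fst (measured (M \<psi> (Some x)) \<rho>)) =
           map_matrix ((*) (trace (measured (M \<psi> (Some x)) \<rho>))) (pure_state_projector \<psi>)) \<and>
        1 - trace (measured (M \<psi> None) \<rho>) = complex_of_real p)"

end

theory Submission
  imports Defs
begin

text \<open>
  Share one maximally entangled pair per port. Alice measures each of her qudits with the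
  projectors \<open>{P, I - P}\<close>, where \<open>P\<close> projects onto the complex conjugate of \<open>\<psi>\<close>, and names the
  first port (in some fixed order) at which she finds \<open>P\<close>. That port then holds \<open>\<psi>\<close>. Each qudit
  is maximally mixed, so each measurement fails independently with probability \<open>1 - 1 / d\<close>.
\<close>

section \<open>Orthogonal projections, used both as effects and as pure states\<close>

definition orthogonal_projection :: "'i::finite operator \<Rightarrow> bool" where
  "orthogonal_projection X \<longleftrightarrow> adjoint_matrix X = X \<and> X ** X = X"

lemma adjoint_matrix_nth [simp]: "adjoint_matrix X $ i $ j = cnj (X $ j $ i)"
  by (simp add: adjoint_matrix_def transpose_def map_matrix_def)

text \<open>Since \<open>X\<close> is self-adjoint and idempotent, its quadratic form at
  \<open>v\<close> is the squared norm of \<open>X *v v\<close>.\<close>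

lemma orthogonal_projection_psd:
  fixes X :: "'i::finite operator"
  assumes "orthogonal_projection X"
  shows "positive_semidefinite X"
proof -
  have herm: "adjoint_matrix X = X" and idem: "X ** X = X"
    using assms by (auto simp: orthogonal_projection_def)
  have cX: "cnj (X $ k $ i) = X $ i $ k" for i k
    using herm by (metis adjoint_matrix_nth)
  have "0 \<le> Re (\<Sum>i\<in>UNIV. cnj (v $ i) * (X *v v) $ i)" for v
  proof -
    have "(\<Sum>i\<in>UNIV. cnj (v $ i) * (X *v v) $ i) = (\<Sum>i\<in>UNIV. cnj (v $ i) * (X *v (X *v v)) $ i)"
      by (simp add: matrix_vector_mul_assoc idem)
    also have "\<dots> = (\<Sum>i\<in>UNIV. \<Sum>k\<in>UNIV. cnj (v $ i) * (X $ i $ k * (X *v v) $ k))"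
      by (simp add: matrix_vector_mult_def sum_distrib_left)
    also have "\<dots> = (\<Sum>k\<in>UNIV. \<Sum>i\<in>UNIV. cnj (v $ i) * (X $ i $ k * (X *v v) $ k))"
      by (rule sum.swap)
    also have "\<dots> = (\<Sum>k\<in>UNIV. cnj ((X *v v) $ k) * (X *v v) $ k)"
    proof (rule sum.cong[OF refl])
      fix k
      have "cnj ((X *v v) $ k) = (\<Sum>i\<in>UNIV. X $ i $ k * cnj (v $ i))"
        by (simp add: matrix_vector_mult_def cX)
      then show "(\<Sum>i\<in>UNIV. cnj (v $ i) * (X $ i $ k * (X *v v) $ k)) = cnj ((X *v v) $ k) * (X *v v) $ k"
        by (simp add: sum_distrib_left mult_ac)
    qed
    finally show ?thesis
      by (simp add: sum_nonneg)
  qed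
  with herm show ?thesis by (simp add: positive_semidefinite_def)
qed

lemma orthogonal_projection_mat_1: "orthogonal_projection (mat 1)"
  unfolding orthogonal_projection_def by (simp only: matrix_mul_lid) (auto simp: vec_eq_iff mat_def)

lemma matrix_add_rdistrib: "(A + B) ** C = A ** C + B ** C"
  by (vector matrix_matrix_mult_def sum.distrib[symmetric] distrib_right)

lemma orthogonal_projection_complement:
  assumes "orthogonal_projection X"
  shows "orthogonal_projection (mat 1 - X)"
proof -
  have "adjoint_matrix X = X" and idem: "X ** X = X"
    using assms by (auto simp: orthogonal_projection_def)
  then have "adjoint_matrix (mat 1 - X) = mat 1 - X"
    by (auto simp: vec_eq_iff mat_def)
  moreover have "X ** (mat 1 - X) = 0"
    using matrix_add_ldistrib[of X X "mat 1 - X"] by (simp add: idem)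
  then have "(mat 1 - X) ** (mat 1 - X) = mat 1 - X"
    using matrix_add_rdistrib[of X "mat 1 - X" "mat 1 - X"] by simp
  ultimately show ?thesis by (simp add: orthogonal_projection_def)
qed

lemma sum_mult_cnj_eq_norm:
  fixes \<phi> :: "complex^'i::finite"
  shows "(\<Sum>i\<in>UNIV. \<phi> $ i * cnj (\<phi> $ i)) = of_real ((norm \<phi>)\<^sup>2)"
  by (simp add: norm_vec_def L2_set_def sum_nonneg flip: complex_norm_square)

lemma orthogonal_projection_pure_state:
  assumes "norm \<phi> = 1"
  shows "orthogonal_projection (pure_state_projector \<phi>)"
proof -
  have "(\<Sum>k\<in>UNIV. \<phi> $ i * cnj (\<phi> $ k) * (\<phi> $ k * cnj (\<phi> $ j))) =
      \<phi> $ i * cnj (\<phi> $ j) * (\<Sum>k\<in>UNIV. \<phi> $ k * cnj (\<phi> $ k))" for i j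
    by (simp add: sum_distrib_left mult_ac)
  then show ?thesis
    unfolding sum_mult_cnj_eq_norm
    by (simp add: orthogonal_projection_def vec_eq_iff pure_state_projector_def
        matrix_matrix_mult_def assms)
qed

lemma trace_pure_state: "norm \<phi> = 1 \<Longrightarrow> trace (pure_state_projector \<phi>) = 1"
  using sum_mult_cnj_eq_norm[of \<phi>] by (simp add: trace_def pure_state_projector_def)

lemma trace_mat_1_complex: "trace (mat 1 :: 'i::finite operator) = of_nat CARD('i)"
  by (simp add: trace_def mat_def)

section \<open>Tensor products of one single-qudit operator per port\<close>

definition port_product :: "('n::finite \<Rightarrow> 'd::finite operator) \<Rightarrow> ('d, 'n) qudits_operator" where
  "port_product X = (\<chi> a b. \<Prod>y\<in>UNIV. X y $ a y $ b y)"

text \<open>Distributivity: choosing a term in every factor is choosing a function. This makes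
  matrix products and traces of port products factor over the ports.\<close>

lemma sum_prod_functions:
  fixes f :: "'n::finite \<Rightarrow> 'd::finite \<Rightarrow> 'a::comm_semiring_1"
  shows "(\<Sum>a\<in>UNIV. \<Prod>y\<in>UNIV. f y (a y)) = (\<Prod>y\<in>UNIV. \<Sum>i\<in>UNIV. f y i)"
  using prod_sum_PiE[of UNIV "\<lambda>_. UNIV" f] by simp

lemma port_product_mult:
  "port_product X ** port_product Y = port_product (\<lambda>y. X y ** Y y)"
  by (simp add: vec_eq_iff port_product_def matrix_matrix_mult_def prod.distrib[symmetric]
      sum_prod_functions[symmetric])

lemma trace_port_product: "trace (port_product X) = (\<Prod>y\<in>UNIV. trace (X y))"
  using sum_prod_functions[of "\<lambda>y i. X y $ i $ i"] by (simp add: trace_def port_product_def)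

lemma orthogonal_projection_port_product:
  assumes "\<And>y. orthogonal_projection (X y)"
  shows "orthogonal_projection (port_product X)"
proof -
  have "adjoint_matrix (port_product X) = port_product (\<lambda>y. adjoint_matrix (X y))"
    by (simp add: vec_eq_iff port_product_def)
  with assms show ?thesis
    by (simp add: orthogonal_projection_def port_product_mult)
qed

text \<open>This is the partial trace of a tensor product over all ports but \<open>x\<close>. The
  modified label \<open>b(x := j)\<close> stands in the row position because Bob's state will turn
  out to be a transpose of Alice's effect.\<close>

lemma sum_port_product_fixed:
  fixes X :: "'n::finite \<Rightarrow> 'd::finite operator"
  shows "(\<Sum>b | b x = i. port_product X $ (b(x := j)) $ b) =
    X x $ j $ i * (\<Prod>y\<in>UNIV - {x}. trace (X y))"
proof -
  \<comment> \<open>The constraint \<open>b x = i\<close> becomes a factor at port \<open>x\<close>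
    that vanishes off \<open>i\<close>, so the sum runs over all functions and factorizes.\<close>
  define f where "f y k = (if y = x then if k = i then X x $ j $ i else 0 else X y $ k $ k)" for y k
  have split: "(\<Prod>y\<in>UNIV. g y) = g x * (\<Prod>y\<in>UNIV - {x}. g y)" for g :: "'n \<Rightarrow> complex"
    by (rule prod.remove) auto
  have entry: "(\<Prod>y\<in>UNIV. f y (b y)) = (if b x = i then port_product X $ (b(x := j)) $ b else 0)" for b
    by (simp add: split f_def port_product_def)
  have "(\<Sum>b | b x = i. port_product X $ (b(x := j)) $ b) = (\<Sum>b\<in>UNIV. \<Prod>y\<in>UNIV. f y (b y))"
    unfolding entry by (simp add: sum.If_cases)
  also have "\<dots> = (\<Prod>y\<in>UNIV. \<Sum>k\<in>UNIV. f y k)"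
    by (rule sum_prod_functions)
  also have "\<dots> = X x $ j $ i * (\<Prod>y\<in>UNIV - {x}. trace (X y))"
    by (simp add: split f_def trace_def)
  finally show ?thesis .
qed

text \<open>Splits \<open>\<Prod>(p + q)\<close> according to the first index, in the order of \<open>e\<close>, where \<open>p\<close> is chosen.\<close>

lemma prod_add_first_choice:
  fixes p q :: "'b \<Rightarrow> 'a::comm_semiring_1" and e :: "'b \<Rightarrow> nat"
  assumes "finite A" and "inj e"
  shows "(\<Prod>y\<in>A. p y + q y) = (\<Prod>y\<in>A. q y) +
    (\<Sum>x\<in>A. \<Prod>y\<in>A. if e y < e x then q y else if y = x then p y else p y + q y)"
  using \<open>finite A\<close>
\<comment> \<open>Indices are added in increasing order of \<open>e\<close>, so the new index
  \<open>m\<close> comes last: each old term gains the factor \<open>p m + q m\<close>, and the new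
  term chooses \<open>q\<close> on \<open>S\<close> and \<open>p\<close> at
  \<open>m\<close>.\<close>
proof (induction A rule: finite_ranking_induct[where f = e])
  case empty
  then show ?case by simp
next
  case (insert m S)
  let ?t = "\<lambda>x y. if e y < e x then q y else if y = x then p y else p y + q y"
  show ?case
  proof (cases "m \<in> S")
    case True
    with insert show ?thesis by (simp add: insert_absorb)
  next
    case False
    have lt: "e y < e m" if "y \<in> S" for y
      using insert.hyps(2)[OF that] \<open>inj e\<close> that False
      by (metis injD le_neq_implies_less)
    have top: "(\<Prod>y\<in>S. ?t m y) = (\<Prod>y\<in>S. q y)"
      by (rule prod.cong) (simp_all add: lt)
    have old: "(\<Sum>x\<in>S. \<Prod>y\<in>insert m S. ?t x y) = (\<Sum>x\<in>S. (p m + q m) * (\<Prod>y\<in>S. ?t x y))"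
    proof (rule sum.cong[OF refl])
      fix x assume "x \<in> S"
      with lt[of x] False have "?t x m = p m + q m" by auto
      with False insert.hyps(1) show "(\<Prod>y\<in>insert m S. ?t x y) = (p m + q m) * (\<Prod>y\<in>S. ?t x y)"
        by simp
    qed
    have "(\<Sum>x\<in>insert m S. \<Prod>y\<in>insert m S. ?t x y) =
        p m * (\<Prod>y\<in>S. q y) + (p m + q m) * (\<Sum>x\<in>S. \<Prod>y\<in>S. ?t x y)"
      unfolding sum.insert[OF insert.hyps(1) False] old
      unfolding prod.insert[OF insert.hyps(1) False] top
      by (simp add: sum_distrib_left)
    with insert.IH insert.hyps(1) False show ?thesis
      by (simp add: algebra_simps)
  qed
qed

section \<open>Alice's measurement\<close>

definition first_success ::
  "('n::finite \<Rightarrow> nat) \<Rightarrow> 'd::finite operator \<Rightarrow> 'n option \<Rightarrow> ('d, 'n) qudits_operator" where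
  "first_success e P z = port_product (\<lambda>y. case z of None \<Rightarrow> mat 1 - P
     | Some x \<Rightarrow> if e y < e x then mat 1 - P else if y = x then P else mat 1)"

text \<open>Each effect is a tensor product of projections, hence a projection. Completeness is the
  expansion of the tensor power of \<open>P + (mat 1 - P)\<close> by the first port where
  \<open>P\<close> is chosen; the later ports keep the whole sum, which is why they carry
  \<open>mat 1\<close>.\<close>

lemma POVM_first_success:
  fixes e :: "'n::finite \<Rightarrow> nat" and P :: "'d::finite operator"
  assumes "inj e" and P: "orthogonal_projection P"
  shows "POVM (first_success e P)"
proof -
  have "positive_semidefinite (first_success e P z)" for z
    unfolding first_success_def
    by (intro orthogonal_projection_psd orthogonal_projection_port_product)
      (auto simp: P orthogonal_projection_complement orthogonal_projection_mat_1 split: option.split)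
  moreover have "(\<Sum>z\<in>UNIV. first_success e P z) $ a $ b = mat 1 $ a $ b" for a b
  proof -
    let ?p = "\<lambda>y. P $ a y $ b y"
    let ?q = "\<lambda>y. (mat 1 - P) $ a y $ b y"
    have "(\<Sum>z\<in>UNIV. first_success e P z) $ a $ b =
        first_success e P None $ a $ b + (\<Sum>x\<in>UNIV. first_success e P (Some x) $ a $ b)"
      by (simp add: UNIV_option_conv sum.reindex)
    also have "\<dots> = (\<Prod>y\<in>UNIV. ?q y) +
        (\<Sum>x\<in>UNIV. \<Prod>y\<in>UNIV. if e y < e x then ?q y else if y = x then ?p y else ?p y + ?q y)"
      unfolding first_success_def port_product_def
      by (auto intro!: sum.cong prod.cong arg_cong2[where f = "(+)"])
    also have "\<dots> = (\<Prod>y\<in>UNIV. ?p y + ?q y)"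
      using prod_add_first_choice[OF finite \<open>inj e\<close>, of ?p ?q UNIV] by simp
    also have "\<dots> = mat 1 $ a $ b"
      by (auto simp: mat_def fun_eq_iff)
    finally show ?thesis .
  qed
  ultimately show ?thesis by (simp add: POVM_def vec_eq_iff)
qed

section \<open>The resource state: the maximally entangled pairs, regrouped into one such pair of
  dimension \<open>CARD('d) ^ CARD('n)\<close>\<close>

definition entangled_pairs :: "complex^(('n::finite \<Rightarrow> 'd::finite) \<times> ('n \<Rightarrow> 'd))" where
  "entangled_pairs =
     (\<chi> r. if fst r = snd r then of_real (1 / sqrt (real CARD('d) ^ CARD('n))) else 0)"

lemma sum_if_fst_eq_snd:
  fixes c :: "'i::finite \<Rightarrow> 'a::comm_monoid_add"
  shows "(\<Sum>r\<in>UNIV. if fst r = snd r then c (fst r) else 0) = (\<Sum>a\<in>UNIV. c a)"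
  by (simp add: UNIV_Times_UNIV[symmetric] sum.cartesian_product' del: UNIV_Times_UNIV)

lemma norm_entangled_pairs:
  "norm (entangled_pairs :: complex^(('n::finite \<Rightarrow> 'd::finite) \<times> ('n \<Rightarrow> 'd))) = 1"
proof -
  let ?D = "real CARD('d) ^ CARD('n)"
  have "(\<Sum>r\<in>UNIV. (norm ((entangled_pairs :: complex^(('n \<Rightarrow> 'd) \<times> ('n \<Rightarrow> 'd))) $ r))\<^sup>2) =
      (\<Sum>r\<in>(UNIV :: (('n \<Rightarrow> 'd) \<times> ('n \<Rightarrow> 'd)) set). if fst r = snd r then 1 / ?D else 0)"
    by (rule sum.cong) (auto simp: entangled_pairs_def norm_divide power_divide norm_power)
  also have "\<dots> = 1"
    using sum_if_fst_eq_snd[of "\<lambda>_::'n \<Rightarrow> 'd. 1 / ?D"] by (simp add: card_fun)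
  finally show ?thesis by (simp add: norm_vec_def L2_set_def)
qed

text \<open>Up to normalization, applying \<open>M\<close> to Alice's half turns the ket into the
  vector of entries of \<open>M\<close>, while the bra stays supported on equal labels.\<close>

lemma measured_entangled_pairs:
  fixes M :: "('d::finite, 'n::finite) qudits_operator"
  shows "measured M (pure_state_projector entangled_pairs) $ (a, b) $ (a', b') =
    (if a' = b' then M $ a $ b / of_nat (CARD('d) ^ CARD('n)) else 0)"
proof -
  let ?D = "of_nat (CARD('d) ^ CARD('n)) :: complex"
  define s where "s = complex_of_real (1 / sqrt (real CARD('d) ^ CARD('n)))"
  have s: "s * cnj s = 1 / ?D"
    unfolding s_def by (simp flip: of_real_mult)
  have proj: "pure_state_projector entangled_pairs $ r $ c =
      (if fst r = snd r then if fst c = snd c then 1 / ?D else 0 else 0)"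
    for r c :: "('n \<Rightarrow> 'd) \<times> ('n \<Rightarrow> 'd)"
    unfolding pure_state_projector_def entangled_pairs_def s_def[symmetric] s[symmetric] by simp
  have "measured M (pure_state_projector entangled_pairs) $ (a, b) $ (a', b') =
      (\<Sum>r\<in>UNIV. if fst r = snd r then
         (if b = fst r then if a' = b' then M $ a $ b / ?D else 0 else 0) else 0)"
    by (auto intro!: sum.cong simp: measured_def matrix_matrix_mult_def tensor_op_def proj mat_def
        simp del: of_nat_power cong: if_cong)
  also have "\<dots> = (if a' = b' then M $ a $ b / ?D else 0)"
    using sum_if_fst_eq_snd[of "\<lambda>c. if b = c then if a' = b' then M $ a $ b / ?D else 0 else 0"]
    by simp
  finally show ?thesis .
qed

text \<open>Alice's half is maximally mixed, so an outcome probability is the normalized trace of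
  its effect.\<close>

lemma trace_measured_entangled_pairs:
  fixes M :: "('d::finite, 'n::finite) qudits_operator"
  shows "trace (measured M (pure_state_projector entangled_pairs)) =
    trace M / of_nat (CARD('d) ^ CARD('n))"
proof -
  have "trace (measured M (pure_state_projector entangled_pairs)) =
      (\<Sum>r\<in>UNIV. if fst r = snd r then M $ fst r $ fst r / of_nat (CARD('d) ^ CARD('n)) else 0)"
    unfolding trace_def by (rule sum.cong) (auto simp: measured_entangled_pairs)
  also have "\<dots> = trace M / of_nat (CARD('d) ^ CARD('n))"
    using sum_if_fst_eq_snd[of "\<lambda>a. M $ a $ a / of_nat (CARD('d) ^ CARD('n))"]
    by (simp add: trace_def sum_divide_distrib)
  finally show ?thesis .
qed

text \<open>The transpose trick: Alice's effect appears on Bob's side transposed, which is why she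
  has to measure along the conjugate of the input.\<close>

lemma partial_trace_measured_entangled_pairs:
  fixes M :: "('d::finite, 'n::finite) qudits_operator"
  shows "partial_trace_fst (measured M (pure_state_projector entangled_pairs)) $ r $ c =
    M $ c $ r / of_nat (CARD('d) ^ CARD('n))"
  by (simp add: partial_trace_fst_def measured_entangled_pairs)

text \<open>Tracing out the other ports leaves the product of their traces. As port \<open>x\<close>
  has trace 1, this is the full trace, so the scalar in front is exactly the outcome
  probability.\<close>

lemma reduce_port_product:
  fixes X :: "'n::finite \<Rightarrow> 'd::finite operator"
  assumes "trace (X x) = 1"
  defines "\<rho>' \<equiv> measured (port_product X) (pure_state_projector entangled_pairs)"
  shows "reduce_to_port x (partial_trace_fst \<rho>') = map_matrix ((*) (trace \<rho>')) (transpose (X x))"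
proof -
  have "(\<Prod>y\<in>UNIV. trace (X y)) = (\<Prod>y\<in>UNIV - {x}. trace (X y))"
    using prod.remove[of UNIV x "\<lambda>y. trace (X y)"] assms(1) by simp
  then show ?thesis
    unfolding \<rho>'_def
    by (simp add: vec_eq_iff reduce_to_port_def partial_trace_measured_entangled_pairs
        trace_measured_entangled_pairs trace_port_product map_matrix_def transpose_def
        sum_port_product_fixed flip: sum_divide_distrib)
qed

section \<open>The protocol and its success probability\<close>

theorem theorem3p1:
  assumes "CARD('d::finite) \<ge> 2" and "CARD('n::finite) \<ge> 1"
  shows "\<exists>(\<rho> :: ('d, 'n) joint_operator)
            (M :: complex^'d \<Rightarrow> 'n option \<Rightarrow> ('d, 'n) qudits_operator).
           probabilistic_PBSP \<rho> M (1 - (1 - 1 / real CARD('d)) ^ CARD('n))"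
proof -
  \<comment> \<open>The port type carries no order; an injection into the naturals supplies the one
    in which Alice looks for her first success.\<close>
  obtain e :: "'n \<Rightarrow> nat" where e: "inj e"
    using finite_imp_inj_to_nat_seg[of "UNIV :: 'n set"] by auto
  define \<rho> :: "('d, 'n) joint_operator" where "\<rho> = pure_state_projector entangled_pairs"
  define conj :: "complex^'d \<Rightarrow> complex^'d" where "conj \<psi> = (\<chi> i. cnj (\<psi> $ i))" for \<psi>
  define M :: "complex^'d \<Rightarrow> 'n option \<Rightarrow> ('d, 'n) qudits_operator"
    where "M \<psi> = first_success e (pure_state_projector (conj \<psi>))" for \<psi>
  have "density_operator \<rho>"
    unfolding \<rho>_def density_operator_def
    by (simp add: norm_entangled_pairs trace_pure_state orthogonal_projection_psd
        orthogonal_projection_pure_state)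
  moreover have "POVM (M \<psi>) \<and>
        (\<forall>x. trace (measured (M \<psi> (Some x)) \<rho>) \<noteq> 0 \<longrightarrow>
           reduce_to_port x (partial_trace_fst (measured (M \<psi> (Some x)) \<rho>)) =
           map_matrix ((*) (trace (measured (M \<psi> (Some x)) \<rho>))) (pure_state_projector \<psi>)) \<and>
        1 - trace (measured (M \<psi> None) \<rho>) =
          complex_of_real (1 - (1 - 1 / real CARD('d)) ^ CARD('n))"
    if \<psi>: "norm \<psi> = 1" for \<psi>
  proof (intro conjI allI impI)
    let ?P = "pure_state_projector (conj \<psi>)"
    have unit: "norm (conj \<psi>) = 1"
      using \<psi> by (simp add: conj_def norm_vec_def)
    have tr: "trace ?P = 1"
      by (rule trace_pure_state[OF unit])
    \<comment> \<open>For a self-adjoint matrix transposing is conjugating, so the effect along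
      \<open>conj \<psi>\<close> leaves \<psi> itself at Bob's port.\<close>
    have transp: "transpose ?P = pure_state_projector \<psi>"
      by (simp add: vec_eq_iff transpose_def pure_state_projector_def conj_def)
    show "POVM (M \<psi>)"
      unfolding M_def by (intro POVM_first_success e orthogonal_projection_pure_state unit)
    show "reduce_to_port x (partial_trace_fst (measured (M \<psi> (Some x)) \<rho>)) =
        map_matrix ((*) (trace (measured (M \<psi> (Some x)) \<rho>))) (pure_state_projector \<psi>)" for x
      unfolding M_def \<rho>_def first_success_def
      by (subst reduce_port_product) (simp_all add: tr transp)
    \<comment> \<open>Aborting means failure at every port: each contributes
      \<open>CARD('d) - 1\<close> to the trace, to be divided by one factor \<open>CARD('d)\<close>
      of the normalization.\<close>
    have "trace (mat 1 - ?P) = of_nat CARD('d) - 1"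
      by (simp add: trace_sub trace_mat_1_complex tr)
    then have "trace (measured (M \<psi> None) \<rho>) =
        (of_nat CARD('d) - 1) ^ CARD('n) / of_nat (CARD('d) ^ CARD('n))"
      by (simp add: M_def \<rho>_def trace_measured_entangled_pairs first_success_def trace_port_product)
    also have "\<dots> = (1 - 1 / of_nat CARD('d)) ^ CARD('n)"
      by (simp add: diff_divide_distrib flip: power_divide)
    finally show "1 - trace (measured (M \<psi> None) \<rho>) =
        complex_of_real (1 - (1 - 1 / real CARD('d)) ^ CARD('n))"
      by simp
  qed
  ultimately show ?thesis
    unfolding probabilistic_PBSP_def by blast
qed

end
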